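(* Let $X$ be a proper CAT(0) space and let $\partial X$ be its visual boundary. Let $\kappa$ be a sublinear function, and let $c, c' : [0,\infty) \to X$ be two distinct geodesic rays with $c(0)=c'(0)$ such that $c$ is $\kappa$-contracting. Let $\zeta=c(\infty)$ and $\eta=c'(\infty)$ be the corresponding (distinct) points of $\partial X$. Let $h$ be a horofunction associated to $c$, and let $H_k=h^{-1}(-k)$. Then: (1) Every sequence $(x_k)$ in $X$ with $h(x_k)\to-\infty$ satisfies $x_k\to\zeta$. In particular, if $\{H_k\}_{k\in\mathbb{N}}$ is a sequence of $h$-horospheres and $x_k\in H_k$ for each $k$, then $x_k\to\zeta$; that is, any sequence of $h$-horospheres is convergent. (2) If $B$ and $B'$ are horoballs centered at $\zeta$ and $\eta$ respectively, then $B\cap B'$ is bounded. (3) If $h'$ is a horofunction associated to $c'$, then $h(c'(s))\to\infty$ as $s\to\infty$ and $h'(c(t))\to\infty$ as $t\to\infty$.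
   Context: A sublinear function is a function $\kappa:[0,\infty)\to[1,\infty)$ that is monotone increasing, concave, and satisfies $\lim_{t\to\infty}\kappa(t)/t=0$. For a geodesic ray $b$ in $X$ let $\pi_b:X\to b$ denote the nearest point projection onto (the image of) $b$. The ray $b$ is $\kappa$-contracting if there is a constant $\mathsf{n}\ge 0$ such that for every ball $B$ centered at a point $x\in X$ with $B\cap b=\emptyset$ one has $\operatorname{diam}(\pi_b(B))\le \mathsf{n}\,\kappa(\|x\|)$, where $\|x\|=d(x,b(0))$. The visual boundary $\partial X$ is the set of geodesic rays modulo the relation of staying at bounded distance ($b\sim c$ iff $\sup_t d(b(t),c(t))<\infty$); the class of $b$ is written $b(\infty)$. Convergence $x_k\to\zeta\in\partial X$ is in the usual cone topology on $X\cup\partial X$: with base point $\mathfrak{o}$ and $c$ the ray from $\mathfrak{o}$ with $c(\infty)=\zeta$, $x_k\to\zeta$ means $d(\mathfrak{o},x_k)\to\infty$ and the geodesic segments $[\mathfrak{o},x_k]$ converge to $c$ uniformly on bounded intervals. The Busemann function of a geodesic ray $c$ is $b_c(x)=\lim_{t\to\infty}[d(x,c(t))-t]$. A horofunction associated to $c$ is a function of the form $h=b_c+\mathsf{n}$ with $\mathsf{n}$ a constant. An $h$-horosphere is a set $H_k=h^{-1}(-k)$, $k\in\mathbb{R}$, and an $h$-horoball is a set $h^{-1}((-\infty,-k])$, $k\in\mathbb{R}$. A horoball centered at $\zeta=c(\infty)$ is an $h$-horoball for some horofunction $h$ associated to $c$. A sequence $\{H_k\}_{k\in\mathbb{N}}$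 of $h$-horospheres (with $h$ associated to $c$, $c(\infty)=\zeta$) is convergent if whenever $x_k\in H_k$ for each $k$, we have $x_k\to\zeta$. *)

theory Defs
  imports "HOL-Analysis.Analysis"
begin

section \<open>CAT(0) spaces\<close>

definition geodesic_path :: "(real \<Rightarrow> 'a::metric_space) \<Rightarrow> 'a \<Rightarrow> 'a \<Rightarrow> bool" where
  "geodesic_path g x y \<longleftrightarrow>
     g 0 = x \<and> g (dist x y) = y \<and>
     (\<forall>s\<in>{0..dist x y}. \<forall>t\<in>{0..dist x y}. dist (g s) (g t) = \<bar>s - t\<bar>)"

text \<open>
  The triangle with vertices \<open>x\<close>, \<open>y\<close>, \<open>z\<close> has the comparison triangle \<open>a\<close>, \<open>b\<close>, \<open>c\<close> in the
  Euclidean plane. It suffices to compare points on two sides issuing from a common vertex \<open>x\<close>: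
  any two distinct sides share a vertex, the vertices are arbitrary, and for two points on the
  same side the distances in \<open>X\<close> and in the plane agree.

  A proper CAT(0) space is a type of sort \<open>{cat0_space, heine_borel}\<close>: the class
  \<open>heine_borel\<close> says that the closed bounded sets, equivalently the closed balls, are compact.
\<close>

class cat0_space = metric_space +
  assumes geodesic_path_exists: "\<exists>g. geodesic_path g x y"
  assumes cat0_inequality:
    "\<lbrakk>geodesic_path f x y; geodesic_path g x z;
      s \<in> {0..dist x y}; t \<in> {0..dist x z};
      dist a b = dist x y; dist a c = dist x z; dist b c = dist y z;
      p \<in> closed_segment a b; dist a p = s;
      q \<in> closed_segment a c; dist a q = t\<rbrakk>
     \<Longrightarrow> dist (f s) (g t) \<le> dist p (q :: real ^ 2)"


section \<open>Geodesic rays and the visual boundary\<close>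

text \<open>
  A ray is defined on \<open>[0,\<infinity>)\<close>; its values at negative parameters are irrelevant. Two such
  functions represent the same ray when they agree on \<open>{0..}\<close>, which is weaker than equality.
\<close>

definition geodesic_ray :: "(real \<Rightarrow> 'a::metric_space) \<Rightarrow> bool" where
  "geodesic_ray c \<longleftrightarrow> (\<forall>s\<ge>0. \<forall>t\<ge>0. dist (c s) (c t) = \<bar>s - t\<bar>)"

definition asymptotic :: "((real \<Rightarrow> 'a::metric_space) \<times> (real \<Rightarrow> 'a)) set" where
  "asymptotic = {(b, c). geodesic_ray b \<and> geodesic_ray c \<and>
                         bdd_above ((\<lambda>t. dist (b t) (c t)) ` {0..})}"

definition visual_boundary :: "(real \<Rightarrow> 'a::metric_space) set set" where
  "visual_boundary = {c. geodesic_ray c} // asymptotic"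

definition endpoint :: "(real \<Rightarrow> 'a::metric_space) \<Rightarrow> (real \<Rightarrow> 'a) set" where
  "endpoint c = asymptotic `` {c}"

lemma endpoint_in_visual_boundary: "geodesic_ray c \<Longrightarrow> endpoint c \<in> visual_boundary"
  unfolding endpoint_def visual_boundary_def by (rule quotientI) simp

text \<open>
  Convergence of a sequence in \<open>X\<close> to a boundary point \<open>\<zeta>\<close> in the cone topology with base point
  \<open>\<oo>\<close>. In a proper CAT(0) space the geodesic paths \<open>\<sigma> k\<close> on \<open>{0..dist \<oo> (x k)}\<close> and the ray
  \<open>c\<close> on \<open>{0..}\<close> exist and are unique. On each bounded interval only those \<open>k\<close> matter for
  which \<open>\<sigma> k\<close> is a geodesic on the whole interval, since \<open>dist \<oo> (x k)\<close> tends to infinity.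
\<close>

definition tends_to_boundary ::
  "'a::metric_space \<Rightarrow> (nat \<Rightarrow> 'a) \<Rightarrow> (real \<Rightarrow> 'a) set \<Rightarrow> bool" where
  "tends_to_boundary \<oo> x \<zeta> \<longleftrightarrow>
     filterlim (\<lambda>k. dist \<oo> (x k)) at_top sequentially \<and>
     (\<exists>c \<sigma>. geodesic_ray c \<and> c 0 = \<oo> \<and> endpoint c = \<zeta> \<and>
        (\<forall>k. geodesic_path (\<sigma> k) \<oo> (x k)) \<and>
        (\<forall>T\<ge>0. uniform_limit {0..T} \<sigma> c sequentially))"


section \<open>Sublinear functions and contracting rays\<close>

definition sublinear :: "(real \<Rightarrow> real) \<Rightarrow> bool" where
  "sublinear \<kappa> \<longleftrightarrow>
     (\<forall>t\<ge>0. \<kappa> t \<ge> 1) \<and> mono_on {0..} \<kappa> \<and> concave_on {0..} \<kappa> \<and>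
     ((\<lambda>t. \<kappa> t / t) \<longlongrightarrow> 0) at_top"

definition ray_proj :: "(real \<Rightarrow> 'a::metric_space) \<Rightarrow> 'a \<Rightarrow> 'a" where
  "ray_proj b x = arg_min_on (dist x) (b ` {0..})"

text \<open>
  Nearest point projections map bounded sets to bounded sets, so \<open>diameter\<close> is the genuine
  diameter here and not its default value for unbounded sets.
\<close>

definition contracting_ray :: "(real \<Rightarrow> real) \<Rightarrow> (real \<Rightarrow> 'a::metric_space) \<Rightarrow> bool" where
  "contracting_ray \<kappa> b \<longleftrightarrow> geodesic_ray b \<and>
     (\<exists>n\<ge>0. \<forall>x r. ball x r \<inter> b ` {0..} = {} \<longrightarrow>
        diameter (ray_proj b ` ball x r) \<le> n * \<kappa> (dist x (b 0)))"


section \<open>Horofunctions, horospheres and horoballs\<close>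

definition busemann :: "(real \<Rightarrow> 'a::metric_space) \<Rightarrow> 'a \<Rightarrow> real" where
  "busemann c x = Lim at_top (\<lambda>t. dist x (c t) - t)"

definition horofunction :: "(real \<Rightarrow> 'a::metric_space) \<Rightarrow> ('a \<Rightarrow> real) \<Rightarrow> bool" where
  "horofunction c h \<longleftrightarrow> geodesic_ray c \<and> (\<exists>n. h = (\<lambda>x. busemann c x + n))"

definition horosphere :: "('a::metric_space \<Rightarrow> real) \<Rightarrow> real \<Rightarrow> 'a set" where
  "horosphere h k = h -` {- k}"

definition horoball :: "('a::metric_space \<Rightarrow> real) \<Rightarrow> real \<Rightarrow> 'a set" where
  "horoball h k = h -` {..- k}"

definition horoball_centered_at :: "(real \<Rightarrow> 'a::metric_space) set \<Rightarrow> 'a set \<Rightarrow> bool" where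
  "horoball_centered_at \<zeta> B \<longleftrightarrow>
     (\<exists>c h k. geodesic_ray c \<and> endpoint c = \<zeta> \<and> horofunction c h \<and> B = horoball h k)"

definition convergent_horospheres ::
  "'a::metric_space \<Rightarrow> (nat \<Rightarrow> 'a set) \<Rightarrow> (real \<Rightarrow> 'a) set \<Rightarrow> bool" where
  "convergent_horospheres \<oo> H \<zeta> \<longleftrightarrow>
     (\<forall>x. (\<forall>k. x k \<in> H k) \<longrightarrow> tends_to_boundary \<oo> x \<zeta>)"

end

theory Submission
  imports Defs "HOL-Real_Asymp.Real_Asymp"
begin

text \<open>
  Write \<open>q(x)\<close> for the parameter of the projection of \<open>x\<close> to \<open>c\<close> and \<open>D(x)\<close> for the distance from
  \<open>x\<close> to \<open>c\<close>. The angle at the projection is at least \<open>\<pi>/2\<close>, so \<open>b\<^sub>c \<ge> - q\<close>. Moving from \<open>x\<close>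
  towards \<open>\<zeta>\<close> by \<open>D(x)/2\<close> lowers \<open>b\<^sub>c\<close> by that amount, while contraction changes \<open>q\<close> only by a
  sublinear error. Hence \<open>b\<^sub>c(x) \<ge> D(x)/2 - q(x) - o(\<parallel>x\<parallel>)\<close>.

  If \<open>D\<close> reaches \<open>\<delta>S\<close> at distance \<open>S\<close> along a geodesic \<open>g\<close>, convexity makes \<open>D(g(s)) \<ge> \<delta>s\<close> from
  then on. Going back along \<open>g\<close> by steps \<open>s \<mapsto> (1 - \<delta>/2)s\<close>, each of which changes \<open>q\<close>
  sublinearly, shows that \<open>q(g(s))\<close> is at most a small multiple of \<open>s\<close>; so \<open>b\<^sub>c(g(s))\<close> grows
  linearly. Consequently a geodesic to a far point with \<open>b\<^sub>c\<close> bounded above stays close to \<open>c\<close>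
  for a long time, which gives (1).

  For (3), linear growth of \<open>b\<^sub>c\<close> along \<open>c'\<close> makes some comparison angle at \<open>c(0)\<close> between
  \<open>c(t)\<close> and \<open>c'(s)\<close> obtuse. Comparison angles are monotone in \<open>s\<close> and \<open>t\<close>, and this
  condition is symmetric in \<open>c\<close> and \<open>c'\<close>, so it makes both Busemann functions grow. A far point
  in both horoballs would bring a point far along \<open>c\<close> close to a horoball at \<open>\<eta>\<close>, contradicting
  (3), which gives (2).
\<close>

section \<open>CAT(0) geometry\<close>

text \<open>Unlike \<open>geodesic_path\<close>, this fixes a length instead of endpoints, so
  restricting, reversing and shifting stay within the notion.\<close>

definition geodesic_on :: "real \<Rightarrow> (real \<Rightarrow> 'a::metric_space) \<Rightarrow> bool" where
  "geodesic_on L g \<longleftrightarrow> (\<forall>s\<in>{0..L}. \<forall>t\<in>{0..L}. dist (g s) (g t) = \<bar>s - t\<bar>)"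

lemma geodesic_onD:
  "geodesic_on L g \<Longrightarrow> 0 \<le> s \<Longrightarrow> s \<le> L \<Longrightarrow> 0 \<le> t \<Longrightarrow> t \<le> L \<Longrightarrow> dist (g s) (g t) = \<bar>s - t\<bar>"
  unfolding geodesic_on_def by auto

lemma geodesic_on_mono: "geodesic_on L g \<Longrightarrow> l \<le> L \<Longrightarrow> geodesic_on l g"
  unfolding geodesic_on_def by auto

lemma geodesic_path_iff:
  "geodesic_path g x y \<longleftrightarrow> g 0 = x \<and> g (dist x y) = y \<and> geodesic_on (dist x y) g"
  unfolding geodesic_path_def geodesic_on_def by auto

lemma geodesic_on_imp_path:
  assumes "geodesic_on L g" "0 \<le> L"
  shows "geodesic_path g (g 0) (g L)"
  using assms geodesic_onD[OF assms(1), of 0 L] by (simp add: geodesic_path_iff)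

lemma geodesic_ray_on: "geodesic_ray c \<Longrightarrow> geodesic_on L c"
  unfolding geodesic_ray_def geodesic_on_def by auto

lemma geodesic_rayD: "geodesic_ray c \<Longrightarrow> 0 \<le> s \<Longrightarrow> 0 \<le> t \<Longrightarrow> dist (c s) (c t) = \<bar>s - t\<bar>"
  unfolding geodesic_ray_def by auto

lemma geodesic_on_exists:
  fixes x y :: "'a::cat0_space"
  obtains g where "g 0 = x" "g (dist x y) = y" "geodesic_on (dist x y) g"
  using geodesic_path_exists[of x y] unfolding geodesic_path_iff by blast

lemma geodesic_on_reverse: "geodesic_on L g \<Longrightarrow> geodesic_on L (\<lambda>s. g (L - s))"
  unfolding geodesic_on_def by auto

lemma geodesic_on_shift: "geodesic_on L g \<Longrightarrow> 0 \<le> a \<Longrightarrow> geodesic_on (L - a) (\<lambda>s. g (a + s))"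
  unfolding geodesic_on_def by auto

text \<open>The law of cosines is recorded through the inner product, so that no angle has to be
  defined later.\<close>

lemma comparison_triangle:
  fixes A B C :: real
  assumes "0 < A" "0 < B" "C \<le> A + B" "A \<le> B + C" "B \<le> A + C"
  obtains b c :: "real^2"
  where "norm b = A" "norm c = B" "dist b c = C" "2 * (b \<bullet> c) = A\<^sup>2 + B\<^sup>2 - C\<^sup>2"
proof -
  \<comment> \<open>With \<open>b\<close> placed on the first axis, the law of cosines forces
    \<open>k\<close> as the first coordinate of \<open>c\<close>. The triangle inequalities give
    \<open>\<bar>k\<bar> \<le> B\<close>, so the second coordinate \<open>l\<close> is real.\<close>
  define k where "k = (A\<^sup>2 + B\<^sup>2 - C\<^sup>2) / (2 * A)"
  define l where "l = sqrt (B\<^sup>2 - k\<^sup>2)"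
  have "\<bar>A\<^sup>2 + B\<^sup>2 - C\<^sup>2\<bar> \<le> 2 * A * B"
  proof -
    have "(A - B)\<^sup>2 \<le> C\<^sup>2"
      using assms by (intro abs_le_square_iff[THEN iffD1]) auto
    moreover have "C\<^sup>2 \<le> (A + B)\<^sup>2"
      using assms by (intro power_mono) auto
    ultimately show ?thesis by (simp add: abs_le_iff power2_eq_square algebra_simps)
  qed
  then have "\<bar>k\<bar> \<le> B"
    using assms by (simp add: k_def abs_mult field_simps)
  then have "k\<^sup>2 \<le> B\<^sup>2"
    using assms by (intro abs_le_square_iff[THEN iffD1]) auto
  then have l2: "l\<^sup>2 = B\<^sup>2 - k\<^sup>2" by (simp add: l_def)
  define b :: "real^2" where "b = A *\<^sub>R axis 1 1"
  define c :: "real^2" where "c = k *\<^sub>R axis 1 1 + l *\<^sub>R axis 2 1"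
  have bb: "b \<bullet> b = A\<^sup>2" and cc: "c \<bullet> c = B\<^sup>2" and bc: "b \<bullet> c = A * k"
    using l2 unfolding b_def c_def
    by (simp_all add: inner_axis_axis inner_add_left inner_add_right power2_eq_square)
  have 2: "2 * (b \<bullet> c) = A\<^sup>2 + B\<^sup>2 - C\<^sup>2"
    using assms bc by (simp add: k_def)
  have "0 \<le> C" using assms by linarith
  have "(dist b c)\<^sup>2 = C\<^sup>2"
    using 2 by (simp add: dist_norm power2_norm_eq_inner inner_diff_left inner_diff_right bb cc
        inner_commute)
  then have "dist b c = C" using \<open>0 \<le> C\<close> by (simp add: power2_eq_iff_nonneg)
  moreover have "norm b = A" "norm c = B"
    using bb cc assms by (simp_all add: norm_eq_sqrt_inner)
  ultimately show ?thesis using that 2 by blast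
qed

text \<open>By the law of cosines, this says that comparison angles at a common vertex are monotone.\<close>

lemma cat0_cosine:
  fixes f g :: "real \<Rightarrow> 'a::cat0_space"
  assumes f: "geodesic_on a f" and g: "geodesic_on b g" and 0: "f 0 = g 0"
    and a: "0 < a" and b: "0 < b" and s: "0 \<le> s" "s \<le> a" and t: "0 \<le> t" "t \<le> b"
  shows "(dist (f s) (g t))\<^sup>2 \<le> s\<^sup>2 + t\<^sup>2 - s * t / (a * b) * (a\<^sup>2 + b\<^sup>2 - (dist (f a) (g b))\<^sup>2)"
proof -
  have pf: "geodesic_path f (f 0) (f a)" and pg: "geodesic_path g (f 0) (g b)"
    using geodesic_on_imp_path f g a b 0 by fastforce+
  have da: "dist (f 0) (f a) = a" and db: "dist (f 0) (g b) = b"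
    using geodesic_onD[OF f, of 0 a] geodesic_onD[OF g, of 0 b] a b 0 by auto
  obtain y z :: "real^2" where y: "norm y = a" and z: "norm z = b"
    and yz: "dist y z = dist (f a) (g b)"
    and in2: "2 * (y \<bullet> z) = a\<^sup>2 + b\<^sup>2 - (dist (f a) (g b))\<^sup>2"
    using comparison_triangle[OF a b, of "dist (f a) (g b)"]
      dist_triangle[of "f a" "g b" "f 0"] dist_triangle[of "f 0" "g b" "f a"]
      dist_triangle[of "f 0" "f a" "g b"] da db
    by (metis dist_commute add.commute)
  \<comment> \<open>\<open>p\<close> and \<open>q\<close> are the comparison points of
    \<open>f s\<close> and \<open>g t\<close>; being multiples of \<open>y\<close> and
    \<open>z\<close>, they have an inner product that \<open>in2\<close> determines.\<close>
  define p where "p = (s / a) *\<^sub>R y"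
  define q where "q = (t / b) *\<^sub>R z"
  have "p \<in> closed_segment 0 y" "q \<in> closed_segment 0 z"
    unfolding p_def q_def closed_segment_def using a b s t by auto
  moreover have np: "norm p = s" "norm q = t"
    unfolding p_def q_def using a b s t y z by auto
  ultimately have "dist (f s) (g t) \<le> dist p q"
    using cat0_inequality[OF pf pg, of s t 0 y z p q] s t y z yz da db by auto
  then have "(dist (f s) (g t))\<^sup>2 \<le> (dist p q)\<^sup>2" by (intro power_mono) auto
  also have "\<dots> = p \<bullet> p + q \<bullet> q - 2 * (p \<bullet> q)"
    by (simp add: dist_norm power2_norm_eq_inner inner_diff_left inner_diff_right inner_commute)
  also have "p \<bullet> p + q \<bullet> q = s\<^sup>2 + t\<^sup>2"
    using np by (simp add: power2_norm_eq_inner[symmetric])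
  also have "2 * (p \<bullet> q) = s * t / (a * b) * (2 * (y \<bullet> z))"
    by (simp add: p_def q_def mult_ac)
  finally show ?thesis unfolding in2 by simp
qed

text \<open>Convexity of the metric: cutting both sides in the same ratio turns the bound of
  \<open>cat0_cosine\<close> into that of a similar Euclidean triangle. Sides of length 0 are
  separate because \<open>cat0_cosine\<close> divides by both lengths.\<close>

lemma dist_fan_le:
  fixes f g :: "real \<Rightarrow> 'a::cat0_space"
  assumes f: "geodesic_on a f" and g: "geodesic_on b g" and 0: "f 0 = g 0"
    and a: "0 \<le> a" and b: "0 \<le> b" and l: "0 \<le> l" "l \<le> 1"
  shows "dist (f (l * a)) (g (l * b)) \<le> l * dist (f a) (g b)"
proof -
  have la: "0 \<le> l * a" "l * a \<le> a" "0 \<le> l * b" "l * b \<le> b"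
    using a b l by (auto simp: mult_left_le_one_le)
  consider "a = 0" | "b = 0" | "0 < a" "0 < b" using a b by fastforce
  then show ?thesis
  proof cases
    case 1
    then show ?thesis
      using geodesic_onD[OF g, of 0 "l * b"] geodesic_onD[OF g, of 0 b] la 0 b by simp
  next
    case 2
    then show ?thesis
      using geodesic_onD[OF f, of "l * a" 0] geodesic_onD[OF f, of a 0] la 0 a by simp
  next
    case 3
    have "(dist (f (l * a)) (g (l * b)))\<^sup>2 \<le> (l * dist (f a) (g b))\<^sup>2"
      using cat0_cosine[OF f g 0 3 la] 3
      by (simp add: field_simps power2_eq_square)
    then show ?thesis by (rule power2_le_imp_le) (use l in simp)
  qed
qed

text \<open>Stewart's formula as an inequality: \<open>cat0_cosine\<close> for \<open>g\<close> and
  the geodesic from \<open>g 0\<close> to \<open>p\<close>, the latter taken at its full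
  length.\<close>

lemma stewart:
  fixes g :: "real \<Rightarrow> 'a::cat0_space"
  assumes g: "geodesic_on a g" and a: "0 < a" and s: "0 \<le> s" "s \<le> a"
  shows "(dist (g s) p)\<^sup>2 \<le> (1 - s / a) * (dist (g 0) p)\<^sup>2 + s / a * (dist (g a) p)\<^sup>2 - s * (a - s)"
proof (cases "p = g 0")
  case True
  have "dist (g s) p = s" "dist (g a) p = a"
    using True geodesic_onD[OF g, of s 0] geodesic_onD[OF g, of a 0] a s by simp_all
  then show ?thesis using True a by (simp add: field_simps power2_eq_square)
next
  case False
  obtain k where k: "k 0 = g 0" "k (dist (g 0) p) = p" "geodesic_on (dist (g 0) p) k"
    by (rule geodesic_on_exists)
  have pos: "0 < dist (g 0) p" using False by simp
  have "(dist (g s) p)\<^sup>2 \<le> s\<^sup>2 + (dist (g 0) p)\<^sup>2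
      - s * dist (g 0) p / (a * dist (g 0) p) * (a\<^sup>2 + (dist (g 0) p)\<^sup>2 - (dist (g a) p)\<^sup>2)"
    using cat0_cosine[OF g k(3) k(1)[symmetric] a pos s, of "dist (g 0) p"] pos k(2) by simp
  also have "\<dots> = (1 - s / a) * (dist (g 0) p)\<^sup>2 + s / a * (dist (g a) p)\<^sup>2 - s * (a - s)"
    using a pos by (simp add: field_simps power2_eq_square)
  finally show ?thesis .
qed

text \<open>Balls are convex: the subtracted term of \<open>stewart\<close> is dropped, leaving a
  convex combination.\<close>

lemma dist_geodesic_le_max:
  fixes g :: "real \<Rightarrow> 'a::cat0_space"
  assumes g: "geodesic_on a g" and s: "0 \<le> s" "s \<le> a"
  shows "dist (g s) p \<le> max (dist (g 0) p) (dist (g a) p)"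
proof (cases "a = 0")
  case True
  then show ?thesis using s by simp
next
  case False
  then have a: "0 < a" using s by simp
  define m where "m = max (dist (g 0) p) (dist (g a) p)"
  have m: "0 \<le> m" "dist (g 0) p \<le> m" "dist (g a) p \<le> m"
    unfolding m_def by (auto simp: le_max_iff_disj)
  have "(dist (g s) p)\<^sup>2
      \<le> (1 - s / a) * (dist (g 0) p)\<^sup>2 + s / a * (dist (g a) p)\<^sup>2 - s * (a - s)"
    by (rule stewart[OF g a s])
  also have "\<dots> \<le> (1 - s / a) * m\<^sup>2 + s / a * m\<^sup>2 - 0"
    using s a m by (intro diff_mono add_mono mult_left_mono power_mono) auto
  also have "\<dots> = m\<^sup>2" by (simp add: algebra_simps)
  finally show ?thesis unfolding m_def[symmetric] using m(1) by (rule power2_le_imp_le)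
qed


section \<open>Asymptotic rays\<close>

text \<open>Equality of classes reduces to the relation itself once \<open>asymptotic\<close> is
  known to be an equivalence on rays.\<close>

lemma endpoint_eq_iff:
  assumes b: "geodesic_ray b" and c: "geodesic_ray c"
  shows "endpoint b = endpoint c \<longleftrightarrow> (\<exists>D. \<forall>t\<ge>0. dist (b t) (c t) \<le> D)"
proof -
  have iff: "(b, c) \<in> asymptotic \<longleftrightarrow> geodesic_ray b \<and> geodesic_ray c \<and> (\<exists>D. \<forall>t\<ge>0. dist (b t) (c t) \<le> D)"
    for b c :: "real \<Rightarrow> 'a"
    unfolding asymptotic_def bdd_above_def by auto
  have "equiv {c :: real \<Rightarrow> 'a. geodesic_ray c} asymptotic"
  proof (rule equivI)
    show "asymptotic \<subseteq> {c :: real \<Rightarrow> 'a. geodesic_ray c} \<times> {c. geodesic_ray c}"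
      unfolding asymptotic_def by auto
    show "refl_on {c :: real \<Rightarrow> 'a. geodesic_ray c} asymptotic"
      by (rule refl_onI) (auto simp: iff)
    show "sym (asymptotic :: ((real \<Rightarrow> 'a) \<times> (real \<Rightarrow> 'a)) set)"
      by (rule symI) (auto simp: iff dist_commute)
    show "trans (asymptotic :: ((real \<Rightarrow> 'a) \<times> (real \<Rightarrow> 'a)) set)"
    proof (rule transI)
      fix u v w :: "real \<Rightarrow> 'a"
      assume "(u, v) \<in> asymptotic" "(v, w) \<in> asymptotic"
      then obtain D E where "\<forall>t\<ge>0. dist (u t) (v t) \<le> D" "\<forall>t\<ge>0. dist (v t) (w t) \<le> E"
        and r: "geodesic_ray u" "geodesic_ray w"
        unfolding iff by blast
      then have "\<forall>t\<ge>0. dist (u t) (w t) \<le> D + E"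
        by (meson add_mono dist_triangle order_trans)
      then show "(u, w) \<in> asymptotic" using r unfolding iff by blast
    qed
  qed
  then show ?thesis
    using b c eq_equiv_class_iff[of "{c. geodesic_ray c}" asymptotic b c] iff[of b c]
    unfolding endpoint_def by auto
qed

text \<open>The ray is the pointwise limit of the geodesics from \<open>p\<close> to
  \<open>c (real n)\<close>. Their comparison angles at \<open>p\<close> shrink, and completeness
  provides the limit.\<close>

lemma asymptotic_ray_exists:
  fixes c :: "real \<Rightarrow> 'a::{cat0_space, complete_space}" and p :: 'a
  assumes c: "geodesic_ray c"
  obtains c1 where "geodesic_ray c1" "c1 0 = p" "endpoint c1 = endpoint c"
proof -
  define d where "d = dist p (c 0)"
  define b where "b n = dist p (c (real n))" for n
  have d: "0 \<le> d" by (simp add: d_def)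
  have "\<exists>g. g 0 = p \<and> g (b n) = c (real n) \<and> geodesic_on (b n) g" for n
    using geodesic_on_exists[of p "c (real n)"] unfolding b_def by blast
  then obtain \<tau> where \<tau>: "\<And>n. \<tau> n 0 = p" "\<And>n. \<tau> n (b n) = c (real n)"
    "\<And>n. geodesic_on (b n) (\<tau> n)"
    by metis
  have bn: "real n - d \<le> b n" "b n \<le> real n + d" for n
    using dist_triangle[of "c 0" "c (real n)" p] dist_triangle[of p "c (real n)" "c 0"]
      geodesic_rayD[OF c, of 0 "real n"] by (auto simp: b_def d_def dist_commute)
  \<comment> \<open>This is the Cauchy estimate, since \<open>b n\<close> tends to infinity while
    \<open>d\<close> and \<open>s\<close> stay fixed.\<close>
  have key: "(dist (\<tau> n s) (\<tau> m s))\<^sup>2 * b n \<le> 8 * d * s\<^sup>2"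
    if nm: "n \<le> m" and s: "0 \<le> s" and n: "2 * d + s < real n" for n m s
  proof -
    define T where "T = real m - real n"
    have m: "2 * d + s < real m" using n nm by linarith
    have s': "s \<le> b n" "s \<le> b m" "0 < b n" "0 < b m" "d \<le> b m"
      using bn[of n] bn[of m] n m s d by linarith+
    have T: "dist (c (real n)) (c (real m)) = T"
      using geodesic_rayD[OF c, of "real n" "real m"] nm by (simp add: T_def)
    have tri: "\<bar>b n - b m\<bar> \<le> T"
      using T dist_triangle[of p "c (real n)" "c (real m)"] dist_triangle[of p "c (real m)" "c (real n)"]
      by (simp add: b_def dist_commute abs_le_iff)
    \<comment> \<open>These are the two factors of \<open>T\<^sup>2 - (b n - b m)\<^sup>2\<close>.
      The first is at most \<open>2 * d\<close> because \<open>b n\<close> and \<open>b m\<close>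
      differ from \<open>n\<close> and \<open>m\<close> by at most \<open>d\<close>.\<close>
    have "(T - b m + b n) * (T + b m - b n) \<le> (2 * d) * (4 * b m)"
      using tri bn[of n] bn[of m] s' d by (intro mult_mono) (auto simp: T_def)
    then have *: "T\<^sup>2 - (b n - b m)\<^sup>2 \<le> 8 * d * b m"
      by (simp add: power2_eq_square algebra_simps)
    have "(dist (\<tau> n s) (\<tau> m s))\<^sup>2 \<le> s\<^sup>2 + s\<^sup>2 - s * s / (b n * b m) * ((b n)\<^sup>2 + (b m)\<^sup>2 - T\<^sup>2)"
      using cat0_cosine[OF \<tau>(3)[of n] \<tau>(3)[of m] _ s'(3,4) s s'(1) s s'(2)] \<tau>(1,2) T by simp
    also have "\<dots> = s\<^sup>2 / (b n * b m) * (T\<^sup>2 - (b n - b m)\<^sup>2)"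
      using s' by (simp add: field_simps power2_eq_square)
    also have "\<dots> \<le> s\<^sup>2 / (b n * b m) * (8 * d * b m)"
      using * s' by (intro mult_left_mono) auto
    also have "\<dots> = 8 * d * s\<^sup>2 / b n" using s' by simp
    finally show ?thesis using s' by (simp add: field_simps)
  qed
  have cauchy: "Cauchy (\<lambda>n. \<tau> n s)" if s: "0 \<le> s" for s
  proof (rule metric_CauchyI)
    fix e :: real assume e: "0 < e"
    obtain N :: nat where N: "2 * d + s + 8 * d * s\<^sup>2 / e\<^sup>2 < real N"
      using reals_Archimedean2 by blast
    have small: "dist (\<tau> n s) (\<tau> m s) < e" if "N \<le> n" "n \<le> m" for n m
    proof -
      have q: "0 \<le> 8 * d * s\<^sup>2 / e\<^sup>2" using d by simp
      have n: "2 * d + s + 8 * d * s\<^sup>2 / e\<^sup>2 < real n" using N that by linarith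
      have bpos: "8 * d * s\<^sup>2 / e\<^sup>2 < b n" using n bn[of n] d s by linarith
      then have "8 * d * s\<^sup>2 < e\<^sup>2 * b n" using e by (simp add: field_simps)
      then have "(dist (\<tau> n s) (\<tau> m s))\<^sup>2 * b n < e\<^sup>2 * b n"
        using key[OF that(2) s] n q by linarith
      then have "(dist (\<tau> n s) (\<tau> m s))\<^sup>2 < e\<^sup>2" using bpos q by simp
      then show ?thesis by (rule power2_less_imp_less) (use e in simp)
    qed
    show "\<exists>M. \<forall>m\<ge>M. \<forall>n\<ge>M. dist (\<tau> m s) (\<tau> n s) < e"
      using small by (metis dist_commute nle_le)
  qed
  define c1 where "c1 s = lim (\<lambda>n. \<tau> n s)" for s
  have lim: "(\<lambda>n. \<tau> n s) \<longlonglongrightarrow> c1 s" if "0 \<le> s" for s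
    unfolding c1_def using cauchy[OF that] by (simp add: Cauchy_convergent_iff convergent_LIMSEQ_iff)
  have ev: "\<forall>\<^sub>F n in sequentially. s \<le> b n \<and> s < real n" for s
  proof -
    obtain N :: nat where "d + \<bar>s\<bar> < real N" using reals_Archimedean2 by blast
    then show ?thesis
      by (intro eventually_sequentiallyI[of N]) (use bn d in \<open>smt (verit) of_nat_le_iff\<close>)
  qed
  have ray: "geodesic_ray c1"
    unfolding geodesic_ray_def
  proof (intro allI impI)
    fix s t :: real assume st: "0 \<le> s" "0 \<le> t"
    have "(\<lambda>n. dist (\<tau> n s) (\<tau> n t)) \<longlonglongrightarrow> dist (c1 s) (c1 t)"
      by (intro tendsto_dist lim st)
    moreover have "\<forall>\<^sub>F n in sequentially. dist (\<tau> n s) (\<tau> n t) = \<bar>s - t\<bar>"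
      using ev[of "max s t"] by eventually_elim (use st \<tau>(3) in \<open>auto intro: geodesic_onD\<close>)
    ultimately show "dist (c1 s) (c1 t) = \<bar>s - t\<bar>"
      by (metis (mono_tags) LIMSEQ_unique tendsto_eventually)
  qed
  have "c1 0 = p" using lim[of 0] \<tau>(1) LIMSEQ_unique[OF _ tendsto_const] by force
  moreover have "dist (c1 s) (c s) \<le> 2 * d" if s: "0 \<le> s" for s
  proof -
    have "dist (\<tau> n s) (c s) \<le> 2 * d" if n: "s \<le> b n" "s < real n" for n
    proof -
      have n0: "0 < real n" using n s by linarith
      \<comment> \<open>Both geodesics are run backwards from their common point
        \<open>c (real n)\<close>. Cutting them in the ratio \<open>l\<close> reaches
        \<open>c s\<close> on one and parameter \<open>s / real n * b n\<close> on the other;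
        correcting that parameter to \<open>s\<close> costs at most another
        \<open>d\<close>.\<close>
      define l where "l = (real n - s) / real n"
      have l: "0 \<le> l" "l \<le> 1" using n0 n s by (auto simp: l_def)
      have e: "real n - l * real n = s" "b n - l * b n = s / real n * b n"
        using n0 by (auto simp: l_def field_simps)
      have "dist (\<tau> n (b n - l * b n)) (c (real n - l * real n)) \<le> l * dist p (c 0)"
        using dist_fan_le[OF geodesic_on_reverse[OF \<tau>(3)[of n]]
            geodesic_on_reverse[OF geodesic_ray_on[OF c, of "real n"]], of l] l n s \<tau>
        by simp
      also have "\<dots> \<le> d" using l d by (simp add: d_def mult_left_le_one_le)
      finally have 1: "dist (\<tau> n (s / real n * b n)) (c s) \<le> d" unfolding e .
      have "dist (\<tau> n s) (\<tau> n (s / real n * b n)) = \<bar>s - s / real n * b n\<bar>"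
        using n s n0 by (intro geodesic_onD[OF \<tau>(3)]) (auto simp: field_simps mult_right_mono)
      also have "\<dots> = s / real n * \<bar>real n - b n\<bar>"
      proof -
        have "s - s / real n * b n = s / real n * (real n - b n)"
          using n0 by (simp add: field_simps)
        then show ?thesis using s n0 by (simp add: abs_mult)
      qed
      also have "\<dots> \<le> 1 * d"
        using bn[of n] s n n0 by (intro mult_mono) auto
      finally show ?thesis using 1 dist_triangle[of "\<tau> n s" "c s" "\<tau> n (s / real n * b n)"] by linarith
    qed
    then have "\<forall>\<^sub>F n in sequentially. dist (\<tau> n s) (c s) \<le> 2 * d"
      using ev[of s] by (auto elim: eventually_mono)
    then show ?thesis
      by (intro tendsto_upperbound[OF tendsto_dist[OF lim[OF s] tendsto_const]]) auto
  qed
  ultimately show ?thesis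
    using that[OF ray] endpoint_eq_iff[OF ray c] by blast
qed

section \<open>Projection to a contracting ray\<close>

text \<open>Encoded as a distance from \<open>c 0\<close>, which determines the projected point
  because \<open>c\<close> is a ray.\<close>

definition proj_param :: "(real \<Rightarrow> 'a::metric_space) \<Rightarrow> 'a \<Rightarrow> real" where
  "proj_param c x = dist (c 0) (ray_proj c x)"

lemma proj_param_nonneg [simp]: "0 \<le> proj_param c x"
  by (simp add: proj_param_def)

lemma
  assumes c: "geodesic_ray c"
  shows ray_proj_eq: "ray_proj c x = c (proj_param c x)"
    and ray_proj_le: "0 \<le> t \<Longrightarrow> dist x (ray_proj c x) \<le> dist x (c t)"
proof -
  \<comment> \<open>Past \<open>R\<close> a point of the ray is farther from \<open>x\<close> than
    \<open>c 0\<close> is, so a minimum over the compact interval is a global one and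
    \<open>arg_min_on\<close> really picks a minimizer.\<close>
  define R where "R = 2 * dist x (c 0)"
  have R: "0 \<le> R" by (simp add: R_def)
  have "continuous_on {0..R} c"
    unfolding continuous_on_iff
  proof (intro ballI allI impI)
    fix s e :: real assume "s \<in> {0..R}" "0 < e"
    then show "\<exists>d>0. \<forall>t\<in>{0..R}. dist t s < d \<longrightarrow> dist (c t) (c s) < e"
      using geodesic_rayD[OF c] by (intro exI[of _ e]) (auto simp: dist_real_def)
  qed
  then have "continuous_on {0..R} (\<lambda>t. dist x (c t))"
    by (intro continuous_intros)
  then obtain q where q: "q \<in> {0..R}" and min: "\<forall>t\<in>{0..R}. dist x (c q) \<le> dist x (c t)"
    using continuous_attains_inf[of "{0..R}" "\<lambda>t. dist x (c t)"] R by auto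
  have all: "dist x (c q) \<le> dist x (c t)" if t: "0 \<le> t" for t
  proof (cases "t \<le> R")
    case True
    then show ?thesis using min t by simp
  next
    case False
    have "dist x (c q) \<le> dist x (c 0)" using min R by simp
    moreover have "t \<le> dist x (c 0) + dist x (c t)"
      using dist_triangle[of "c 0" "c t" x] geodesic_rayD[OF c, of 0 t] t by (simp add: dist_commute)
    ultimately show ?thesis using False by (simp add: R_def)
  qed
  have "\<exists>y. is_arg_min (dist x) (\<lambda>y. y \<in> c ` {0..}) y"
    using q all by (intro exI[of _ "c q"]) (auto simp: is_arg_min_linorder)
  then have "is_arg_min (dist x) (\<lambda>y. y \<in> c ` {0..}) (ray_proj c x)"
    unfolding ray_proj_def arg_min_on_def arg_min_def by (rule someI_ex)
  then have *: "ray_proj c x \<in> c ` {0..}" "\<forall>y\<in>c ` {0..}. dist x (ray_proj c x) \<le> dist x y"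
    unfolding is_arg_min_linorder by auto
  then obtain r where r: "0 \<le> r" "ray_proj c x = c r" by auto
  then show "ray_proj c x = c (proj_param c x)"
    using geodesic_rayD[OF c, of 0 r] by (simp add: proj_param_def)
  show "0 \<le> t \<Longrightarrow> dist x (ray_proj c x) \<le> dist x (c t)" using * by auto
qed

text \<open>Otherwise the comparison angle at the projection would be acute, and moving from the
  projection towards \<open>c t\<close> would come closer to \<open>x\<close>. Letting
  \<open>t\<close> grow bounds the Busemann function below by minus the projection
  parameter.\<close>

lemma dist_ge_diff_proj_param:
  fixes c :: "real \<Rightarrow> 'a::cat0_space"
  assumes c: "geodesic_ray c" and t: "0 \<le> t"
  shows "t - proj_param c x \<le> dist x (c t)"
proof (rule ccontr)
  define q where "q = proj_param c x"
  define T where "T = t - q"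
  define D where "D = dist x (c q)"
  define E where "E = dist x (c t)"
  assume "\<not> ?thesis"
  then have ET: "E < T" by (simp add: E_def T_def q_def)
  have E: "0 \<le> E" by (simp add: E_def)
  then have T: "0 < T" using ET by simp
  have q: "0 \<le> q" by (simp add: q_def)
  have sq: "E\<^sup>2 < T\<^sup>2" using ET E by (intro power_strict_mono) auto
  \<comment> \<open>With this \<open>u\<close>, \<open>T * (T - u)\<close> is the mean of
    \<open>T\<^sup>2\<close> and \<open>E\<^sup>2\<close>, which exceeds \<open>E\<^sup>2\<close>
    and contradicts \<open>stewart\<close>.\<close>
  define u where "u = (T\<^sup>2 - E\<^sup>2) / (2 * T)"
  have u: "0 < u" "u \<le> T"
    using sq T by (auto simp: u_def field_simps power2_eq_square)
  have g: "geodesic_on T (\<lambda>s. c (q + s))"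
    using geodesic_on_shift[OF geodesic_ray_on[OF c, of t] q] by (simp add: T_def)
  have "D \<le> dist x (c (q + u))"
    using ray_proj_le[OF c, of "q + u" x] ray_proj_eq[OF c, of x] q u by (simp add: D_def q_def)
  then have "D\<^sup>2 \<le> (dist x (c (q + u)))\<^sup>2" by (intro power_mono) (auto simp: D_def)
  also have "\<dots> \<le> (1 - u / T) * D\<^sup>2 + u / T * E\<^sup>2 - u * (T - u)"
    using stewart[OF g T, of u x] u by (simp add: D_def E_def T_def dist_commute)
  finally have "u * (D\<^sup>2 + T * (T - u)) \<le> u * E\<^sup>2" using T by (simp add: field_simps)
  then have "D\<^sup>2 + T * (T - u) \<le> E\<^sup>2" using u by simp
  moreover have "T * (T - u) = (T\<^sup>2 + E\<^sup>2) / 2"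
    using T by (simp add: u_def field_simps power2_eq_square)
  ultimately have "(T\<^sup>2 + E\<^sup>2) / 2 \<le> E\<^sup>2" using zero_le_power2[of D] by linarith
  then show False using sq by simp
qed

text \<open>Pointwise form of contraction, obtained from the largest open ball about
  \<open>x\<close> that misses the ray.\<close>

lemma contracting_ray_projE:
  assumes "contracting_ray \<kappa> c"
  obtains n where "0 \<le> n"
    "\<And>x y. dist x y < dist x (ray_proj c x) \<Longrightarrow>
       dist (ray_proj c x) (ray_proj c y) \<le> n * \<kappa> (dist x (c 0))"
proof -
  have c: "geodesic_ray c" using assms by (simp add: contracting_ray_def)
  obtain n where n: "0 \<le> n" "\<And>x r. ball x r \<inter> c ` {0..} = {} \<Longrightarrow>
        diameter (ray_proj c ` ball x r) \<le> n * \<kappa> (dist x (c 0))"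
    using assms unfolding contracting_ray_def by blast
  have "dist (ray_proj c x) (ray_proj c y) \<le> n * \<kappa> (dist x (c 0))"
    if xy: "dist x y < dist x (ray_proj c x)" for x y
  proof -
    define r where "r = dist x (ray_proj c x)"
    have r: "0 < r" unfolding r_def using xy zero_le_dist by (rule le_less_trans[rotated])
    have "ball x r \<inter> c ` {0..} = {}"
      using ray_proj_le[OF c, of _ x] by (force simp: r_def)
    then have d: "diameter (ray_proj c ` ball x r) \<le> n * \<kappa> (dist x (c 0))" by (rule n(2))
    \<comment> \<open>\<open>diameter\<close> bounds the distances between points only for a bounded
      set.\<close>
    have "bounded (ray_proj c ` ball x r)"
      unfolding bounded_def
    proof (intro exI ballI)
      fix z assume "z \<in> ray_proj c ` ball x r"
      then obtain y where y: "dist x y < r" "z = ray_proj c y" by auto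
      have "dist y (ray_proj c y) \<le> dist y (c 0)" by (rule ray_proj_le[OF c]) simp
      also have "\<dots> \<le> r + dist x (c 0)"
        using dist_triangle[of y "c 0" x] y by (simp add: dist_commute)
      finally show "dist x z \<le> r + (r + dist x (c 0))"
        using dist_triangle[of x z y] y by simp
    qed
    moreover have "x \<in> ball x r" "y \<in> ball x r"
      using xy r unfolding r_def[symmetric] by simp_all
    ultimately show ?thesis using diameter_bounded_bound d by (meson imageI order_trans)
  qed
  then show ?thesis using that n(1) by blast
qed

section \<open>Sublinear errors and linear escape from a contracting ray\<close>

lemma sublinear_bound:
  assumes "sublinear \<kappa>" "0 \<le> n" "0 < \<epsilon>"
  obtains S0 where "0 < S0" "\<And>s. S0 \<le> s \<Longrightarrow> n * \<kappa> (s + d) \<le> \<epsilon> * s"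
proof -
  \<comment> \<open>The factor 2 absorbs the shift, as \<open>s + d \<le> 2 * s\<close> from
    \<open>S0\<close> on; \<open>n + 1\<close> allows for \<open>n = 0\<close>.\<close>
  define e where "e = \<epsilon> / (2 * (n + 1))"
  have e: "0 < e" using assms by (simp add: e_def)
  have "((\<lambda>t. \<kappa> t / t) \<longlongrightarrow> 0) at_top" using assms(1) by (simp add: sublinear_def)
  then have "\<forall>\<^sub>F t in at_top. \<kappa> t / t < e" using e by (rule order_tendstoD)
  then obtain N where N: "\<And>t. N \<le> t \<Longrightarrow> \<kappa> t / t < e"
    unfolding eventually_at_top_linorder by blast
  define S0 where "S0 = \<bar>N\<bar> + 2 * \<bar>d\<bar> + 1"
  have "n * \<kappa> (s + d) \<le> \<epsilon> * s" if s: "S0 \<le> s" for s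
  proof -
    have sd: "0 < s + d" "N \<le> s + d" "s + d \<le> 2 * s" using s by (auto simp: S0_def)
    then have "\<kappa> (s + d) \<le> e * (s + d)" using N[of "s + d"] by (simp add: field_simps)
    also have "\<dots> \<le> e * (2 * s)" using sd e by simp
    finally have "n * \<kappa> (s + d) \<le> n * (e * (2 * s))" using assms by (intro mult_left_mono)
    also have "\<dots> \<le> (n + 1) * (e * (2 * s))"
      using e s by (intro mult_right_mono) (auto simp: S0_def)
    also have "\<dots> = \<epsilon> * s" using assms by (simp add: e_def field_simps)
    finally show ?thesis .
  qed
  moreover have "0 < S0" by (simp add: S0_def)
  ultimately show ?thesis using that by blast
qed


text \<open>Moving from \<open>x\<close> towards \<open>c t\<close> by half the distance to the ray
  stays strictly inside the ball of contraction, so the projection parameter grows by at most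
  \<open>K\<close>. Applying \<open>dist_ge_diff_proj_param\<close> at the new point gains the
  length moved.\<close>

lemma contracting_dist_ge:
  fixes c :: "real \<Rightarrow> 'a::cat0_space"
  assumes c: "geodesic_ray c" and t: "0 \<le> t"
    and K: "\<And>y. dist x y < dist x (ray_proj c x) \<Longrightarrow> dist (ray_proj c x) (ray_proj c y) \<le> K"
    and K0: "0 \<le> K"
  shows "dist x (ray_proj c x) / 2 - proj_param c x - K \<le> dist x (c t) - t"
proof (cases "dist x (ray_proj c x) = 0")
  case True
  then show ?thesis using dist_ge_diff_proj_param[OF c t, of x] K0 by simp
next
  case False
  define r where "r = dist x (ray_proj c x) / 2"
  have r: "0 < r" using False by (simp add: r_def)
  obtain g where g: "g 0 = x" "g (dist x (c t)) = c t" "geodesic_on (dist x (c t)) g"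
    by (rule geodesic_on_exists)
  have rt: "r \<le> dist x (c t)" using ray_proj_le[OF c t, of x] zero_le_dist[of x "c t"] unfolding r_def by linarith
  have xr: "dist x (g r) = r" "dist (g r) (c t) = dist x (c t) - r"
    using geodesic_onD[OF g(3), of 0 r] geodesic_onD[OF g(3), of r "dist x (c t)"] g r rt
    by simp_all
  have "dist x (g r) < dist x (ray_proj c x)" using xr(1) r unfolding r_def by linarith
  then have "dist (ray_proj c x) (ray_proj c (g r)) \<le> K" by (rule K)
  then have "proj_param c (g r) \<le> proj_param c x + K"
    using dist_triangle[of "c 0" "ray_proj c (g r)" "ray_proj c x"] by (simp add: proj_param_def)
  then show ?thesis
    using dist_ge_diff_proj_param[OF c t, of "g r"] xr by (simp add: r_def)
qed

text \<open>Convexity of the distance to the ray, up to an error because \<open>g\<close> may start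
  off \<open>c 0\<close>. A diagonal \<open>k\<close> splits the quadrilateral into two triangles,
  each handled by \<open>dist_fan_le\<close>.\<close>

lemma dist_ray_proj_scale:
  fixes c :: "real \<Rightarrow> 'a::cat0_space"
  assumes c: "geodesic_ray c" and g: "geodesic_on s g" and S: "0 \<le> S" "S \<le> s" and s: "0 < s"
  shows "dist (g S) (ray_proj c (g S)) \<le> S / s * dist (g s) (ray_proj c (g s)) + dist (g 0) (c 0)"
proof -
  define q where "q = proj_param c (g s)"
  define l where "l = S / s"
  have l: "0 \<le> l" "l \<le> 1" "l * s = S" using S s by (auto simp: l_def)
  have q: "0 \<le> q" "ray_proj c (g s) = c q" by (simp_all add: q_def ray_proj_eq[OF c])
  obtain k where k: "k 0 = g 0" "k (dist (g 0) (c q)) = c q" "geodesic_on (dist (g 0) (c q)) k"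
    by (rule geodesic_on_exists)
  define b where "b = dist (g 0) (c q)"
  have 1: "dist (g S) (k (l * b)) \<le> l * dist (g s) (c q)"
    using dist_fan_le[OF g k(3) k(1)[symmetric] _ _ l(1,2)] s l(3) k(2) by (simp add: b_def)
  have "b - (1 - l) * b = l * b" "q - (1 - l) * q = l * q" by (auto simp: algebra_simps)
  then have "dist (k (l * b)) (c (l * q)) \<le> (1 - l) * dist (g 0) (c 0)"
    using dist_fan_le[OF geodesic_on_reverse[OF k(3)] geodesic_on_reverse[OF geodesic_ray_on[OF c, of q]],
        of "1 - l"] k(1,2) q l by (simp add: b_def)
  also have "\<dots> \<le> dist (g 0) (c 0)" using l by (simp add: mult_left_le_one_le)
  finally have "dist (g S) (c (l * q)) \<le> l * dist (g s) (c q) + dist (g 0) (c 0)"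
    using 1 dist_triangle[of "g S" "c (l * q)" "k (l * b)"] by linarith
  then show ?thesis
    using ray_proj_le[OF c, of "l * q" "g S"] q l(1) unfolding l_def[symmetric] by fastforce
qed

text \<open>\<open>S0\<close> precedes the geodesic and \<open>t\<close>: one threshold serves all
  geodesics, and the bound passes to the limit in \<open>t\<close>, hence to the Busemann
  function.\<close>

lemma escape_estimate:
  fixes c :: "real \<Rightarrow> 'a::cat0_space"
  assumes \<kappa>: "sublinear \<kappa>" and con: "contracting_ray \<kappa> c"
    and \<delta>: "0 < \<delta>" "\<delta> \<le> 1" and d: "0 \<le> d"
  obtains S0 where "0 < S0"
    "\<And>S L g t. S0 \<le> S \<Longrightarrow> S \<le> L \<Longrightarrow> geodesic_on L g \<Longrightarrow> dist (g 0) (c 0) = d \<Longrightarrow>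
       \<delta> * S + d \<le> dist (g S) (ray_proj c (g S)) \<Longrightarrow> 0 \<le> t \<Longrightarrow>
       \<delta> / 4 * L - 2 * (S + d) \<le> dist (g L) (c t) - t"
proof -
  have c: "geodesic_ray c" using con by (simp add: contracting_ray_def)
  obtain n where n: "0 \<le> n" "\<And>x y. dist x y < dist x (ray_proj c x) \<Longrightarrow>
       dist (ray_proj c x) (ray_proj c y) \<le> n * \<kappa> (dist x (c 0))"
    using contracting_ray_projE[OF con] by blast
  \<comment> \<open>At the end \<open>D L / 2\<close> contributes at least
    \<open>\<delta> * L / 2\<close>. This \<epsilon> limits the losses to
    \<open>\<delta> * L / 8\<close> from the steps and \<open>\<delta> * L / 16\<close> from the
    last contraction, so \<open>\<delta> * L / 4\<close> survives.\<close>
  define \<epsilon> where "\<epsilon> = \<delta>\<^sup>2 / 16"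
  have \<epsilon>: "0 < \<epsilon>" using \<delta> by (simp add: \<epsilon>_def)
  obtain S0 where S0: "0 < S0" "\<And>s. S0 \<le> s \<Longrightarrow> n * \<kappa> (s + d) \<le> \<epsilon> * s"
    using sublinear_bound[OF \<kappa> n(1) \<epsilon>, of d] by blast
  have "\<delta> / 4 * L - 2 * (S + d) \<le> dist (g L) (c t) - t"
    if S: "S0 \<le> S" "S \<le> L" and g: "geodesic_on L g" and g0: "dist (g 0) (c 0) = d"
      and far: "\<delta> * S + d \<le> dist (g S) (ray_proj c (g S))" and t: "0 \<le> t" for S L g t
  proof -
    define D where "D s = dist (g s) (ray_proj c (g s))" for s
    define q where "q s = proj_param c (g s)" for s
    have Spos: "0 < S" using S S0 by linarith
    have norm: "dist (g s) (c 0) \<le> s + d" if "0 \<le> s" "s \<le> L" for s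
      using dist_triangle[of "g s" "c 0" "g 0"] geodesic_onD[OF g that(1,2), of 0] that g0 by simp
    have K: "dist (ray_proj c (g s)) (ray_proj c y) \<le> \<epsilon> * s"
      if s: "S \<le> s" "s \<le> L" and y: "dist (g s) y < D s" for s y
    proof -
      have "\<kappa> (dist (g s) (c 0)) \<le> \<kappa> (s + d)"
        using \<kappa> norm[of s] s Spos d unfolding sublinear_def
        by (auto elim!: mono_onD)
      then have "n * \<kappa> (dist (g s) (c 0)) \<le> \<epsilon> * s"
        using S0(2)[of s] s S n(1) by (meson mult_left_mono order_trans)
      then show ?thesis using n(2) y unfolding D_def by (meson order_trans)
    qed
    \<comment> \<open>The summand \<open>d\<close> in the hypothesis on \<open>g S\<close> cancels
      the error term of \<open>dist_ray_proj_scale\<close>.\<close>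
    have D: "\<delta> * s \<le> D s" if s: "S \<le> s" "s \<le> L" for s
    proof -
      have "D S \<le> S / s * D s + d"
        using dist_ray_proj_scale[OF c geodesic_on_mono[OF g s(2)], of S] s Spos g0
        unfolding D_def by simp
      then have "\<delta> * S \<le> S / s * D s" using far unfolding D_def by linarith
      then show ?thesis using s Spos by (simp add: field_simps)
    qed
    \<comment> \<open>Such a step is shorter than \<open>D s\<close>, so \<open>g s'\<close> lies in
      the ball about \<open>g s\<close> that misses the ray.\<close>
    have step: "q s \<le> q s' + \<epsilon> * s"
      if s: "S \<le> s'" "s' \<le> s" "s \<le> L" "s - s' \<le> \<delta> / 2 * s" for s s'
    proof -
      have "0 < s" using Spos s by linarith
      have "\<delta> / 2 * s < \<delta> * s" using \<delta> \<open>0 < s\<close> by simp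
      then have "dist (g s) (g s') < D s"
        using geodesic_onD[OF g, of s s'] D[of s] s Spos by simp
      then have "dist (ray_proj c (g s)) (ray_proj c (g s')) \<le> \<epsilon> * s"
        using K s by simp
      then show ?thesis
        using dist_triangle[of "c 0" "ray_proj c (g s)" "ray_proj c (g s')"]
        by (simp add: q_def proj_param_def dist_commute)
    qed
    \<comment> \<open>Each backward step has length at least \<open>\<delta> / 2 * S\<close>, so
      finitely many reach \<open>S\<close>. The errors form a geometric series of ratio
      \<open>1 - \<delta> / 2\<close>, whose sum is at most
      \<open>2 * \<epsilon> / \<delta> * s\<close>.\<close>
    have "q s \<le> 2 * \<epsilon> / \<delta> * s + q S"
      if "S \<le> s" "s \<le> L" "s - S \<le> real k * (\<delta> / 2 * S)" for k s
      using that
    proof (induction k arbitrary: s)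
      case 0
      then show ?case using \<epsilon> \<delta> Spos by simp
    next
      case (Suc k)
      have "\<epsilon> * (\<delta> * s) \<le> \<epsilon> * (2 * s)"
        using \<epsilon> \<delta> Suc.prems Spos by (intro mult_left_mono mult_right_mono) auto
      then have \<epsilon>2: "\<epsilon> * s \<le> 2 * \<epsilon> / \<delta> * s"
        using \<delta> by (simp add: field_simps)
      show ?case
      \<comment> \<open>If a full step would pass \<open>S\<close>, a single shorter step lands on
        \<open>S\<close> itself.\<close>
      proof (cases "s - \<delta> / 2 * s \<le> S")
        case True
        then show ?thesis using step[of S s] Suc.prems \<epsilon>2 by simp
      next
        case False
        define s' where "s' = s - \<delta> / 2 * s"
        have le: "\<delta> / 2 * S \<le> \<delta> / 2 * s" using Suc.prems \<delta> by simp
        have "s - S \<le> \<delta> / 2 * S + real k * (\<delta> / 2 * S)"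
          using Suc.prems(3) unfolding of_nat_Suc distrib_right by simp
        then have "s' - S \<le> real k * (\<delta> / 2 * S)" using le unfolding s'_def by linarith
        moreover have "0 \<le> \<delta> / 2 * s" using \<delta> Spos Suc.prems(1) by simp
        ultimately have s': "S \<le> s'" "s' \<le> s" "s' - S \<le> real k * (\<delta> / 2 * S)"
          using False unfolding s'_def by linarith+
        then have "q s' \<le> 2 * \<epsilon> / \<delta> * s' + q S" using Suc by simp
        moreover have "q s \<le> q s' + \<epsilon> * s"
          using step[OF s'(1,2)] Suc.prems by (simp add: s'_def)
        moreover have "2 * \<epsilon> / \<delta> * s' + \<epsilon> * s = 2 * \<epsilon> / \<delta> * s"
          using \<delta> by (simp add: s'_def field_simps)
        ultimately show ?thesis by linarith
      qed
    qed
    moreover obtain k :: nat where "(L - S) / (\<delta> / 2 * S) \<le> real k"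
      using real_arch_simple by blast
    then have "L - S \<le> real k * (\<delta> / 2 * S)" using \<delta> Spos by (simp add: field_simps)
    ultimately have "q L \<le> 2 * \<epsilon> / \<delta> * L + q S" using S by blast
    also have "2 * \<epsilon> / \<delta> * L = \<delta> * L / 8"
      using \<delta> by (simp add: \<epsilon>_def power2_eq_square)
    finally have "q L \<le> \<delta> * L / 8 + q S" .
    moreover have "q S \<le> 2 * (S + d)"
      using dist_triangle[of "c 0" "ray_proj c (g S)" "g S"] ray_proj_le[OF c, of 0 "g S"]
        norm[of S] S Spos by (simp add: q_def proj_param_def dist_commute)
    moreover have "D L / 2 - q L - \<epsilon> * L \<le> dist (g L) (c t) - t"
      using contracting_dist_ge[OF c t, of "g L" "\<epsilon> * L"] K[of L] S \<epsilon> Spos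
      unfolding D_def q_def by simp
    moreover have "\<epsilon> * L \<le> \<delta> * L / 16"
      using \<delta> S Spos mult_left_le_one_le[of "\<delta> * L" \<delta>]
      by (simp add: \<epsilon>_def power2_eq_square mult_ac)
    moreover have "\<delta> * L \<le> D L" using D S by simp
    moreover have "0 \<le> \<delta> * L" using \<delta> S Spos by simp
    ultimately have "\<delta> * L / 4 - 2 * (S + d) \<le> dist (g L) (c t) - t" by argo
    then show ?thesis by simp
  qed
  then show ?thesis using that S0(1) by blast
qed

section \<open>Busemann functions\<close>

text \<open>By the triangle inequality \<open>dist x (c t) - t\<close> decreases in \<open>t\<close>
  and is bounded below, so \<open>Lim\<close> is a genuine limit and equals the infimum.\<close>

lemma
  assumes c: "geodesic_ray c"
  shows busemann_tendsto: "((\<lambda>t. dist x (c t) - t) \<longlongrightarrow> busemann c x) at_top"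
    and busemann_le: "0 \<le> t \<Longrightarrow> busemann c x \<le> dist x (c t) - t"
proof -
  define f where "f t = dist x (c t) - t" for t
  define l where "l = Inf (f ` {0..})"
  have anti: "f t \<le> f s" if "0 \<le> s" "s \<le> t" for s t
    using dist_triangle[of x "c t" "c s"] geodesic_rayD[OF c, of s t] that by (simp add: f_def)
  have "- dist x (c 0) \<le> f t" if "0 \<le> t" for t
    using dist_triangle[of "c 0" "c t" x] geodesic_rayD[OF c, of 0 t] that
    by (simp add: f_def dist_commute)
  then have bdd: "bdd_below (f ` {0..})" by (intro bdd_belowI[of _ "- dist x (c 0)"]) auto
  then have le: "l \<le> f t" if "0 \<le> t" for t using that by (auto simp: l_def intro: cInf_lower)
  have "(f \<longlongrightarrow> l) at_top"
  proof (rule decreasing_tendsto)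
    show "\<forall>\<^sub>F t in at_top. l \<le> f t"
      using eventually_ge_at_top[of 0] by eventually_elim (rule le)
    fix y assume "l < y"
    then obtain s where s: "0 \<le> s" "f s < y"
      using cInf_less_iff[OF _ bdd, of y] by (auto simp: l_def)
    show "\<forall>\<^sub>F t in at_top. f t < y"
      using eventually_ge_at_top[of s] by eventually_elim (use anti s in force)
  qed
  moreover from this have "busemann c x = l"
    unfolding busemann_def f_def by (intro tendsto_Lim) auto
  ultimately show "((\<lambda>t. dist x (c t) - t) \<longlongrightarrow> busemann c x) at_top"
    and "0 \<le> t \<Longrightarrow> busemann c x \<le> dist x (c t) - t"
    using le unfolding f_def by simp_all
qed

lemma busemann_geI:
  assumes "geodesic_ray c" "\<And>t. a \<le> t \<Longrightarrow> m \<le> dist x (c t) - t"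
  shows "m \<le> busemann c x"
proof (rule tendsto_lowerbound[OF busemann_tendsto[OF assms(1)]])
  show "\<forall>\<^sub>F t in at_top. m \<le> dist x (c t) - t"
    using eventually_ge_at_top[of a] by eventually_elim (rule assms(2))
qed simp

lemma busemann_ge_neg_dist:
  assumes "geodesic_ray c"
  shows "- dist x (c 0) \<le> busemann c x"
proof (rule busemann_geI[OF assms, of 0])
  fix t :: real assume "0 \<le> t"
  then show "- dist x (c 0) \<le> dist x (c t) - t"
    using dist_triangle[of "c 0" "c t" x] geodesic_rayD[OF assms, of 0 t]
    by (simp add: dist_commute)
qed

text \<open>A horoball at a boundary point may come from any ray of the class; this encloses it in a
  sublevel set for a chosen ray.\<close>

lemma busemann_asymptotic_le:
  assumes b: "geodesic_ray b" and c: "geodesic_ray c" and "endpoint b = endpoint c"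
  obtains D where "\<And>x. busemann b x \<le> busemann c x + D"
proof -
  obtain D where D: "\<forall>t\<ge>0. dist (b t) (c t) \<le> D"
    using assms endpoint_eq_iff[OF b c] by blast
  have "busemann b x - D \<le> busemann c x" for x
  proof (rule busemann_geI[OF c, of 0])
    fix t :: real assume t: "0 \<le> t"
    then show "busemann b x - D \<le> dist x (c t) - t"
      using busemann_le[OF b t, of x] dist_triangle[of x "b t" "c t"] D
      by (smt (verit) dist_commute)
  qed
  then show ?thesis using that[of D] by (simp add: algebra_simps)
qed

section \<open>Geodesics to far points of a horoball\<close>

text \<open>A geodesic far from \<open>c\<close> at parameter \<open>S\<close> would escape linearly
  and end where the Busemann function exceeds \<open>M\<close>. So it is near \<open>c\<close> at
  \<open>S\<close>, and convexity shrinks the gap on \<open>{0..T}\<close>. The ray \<open>b\<close>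
  permits any base point.\<close>

lemma visibility_estimate:
  fixes b c :: "real \<Rightarrow> 'a::cat0_space"
  assumes \<kappa>: "sublinear \<kappa>" and con: "contracting_ray \<kappa> c"
    and b: "geodesic_ray b" and bc: "endpoint b = endpoint c"
    and e: "0 < e" and T: "0 \<le> T"
  obtains R where "\<And>x g u. R \<le> dist (b 0) x \<Longrightarrow> geodesic_path g (b 0) x \<Longrightarrow>
     busemann c x \<le> M \<Longrightarrow> u \<in> {0..T} \<Longrightarrow> dist (g u) (b u) \<le> e"
proof -
  have c: "geodesic_ray c" using con by (simp add: contracting_ray_def)
  obtain D0 where D0: "\<forall>t\<ge>0. dist (b t) (c t) \<le> D0"
    using bc endpoint_eq_iff[OF b c] by blast
  have D0pos: "0 \<le> D0" using D0 zero_le_dist order_trans by blast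
  define d where "d = dist (b 0) (c 0)"
  have d: "0 \<le> d" by (simp add: d_def)
  \<comment> \<open>Scaling the gap at \<open>S\<close> down to \<open>T\<close> leaves
    \<open>2 * \<delta> * T\<close> and \<open>T * (3 * d + D0) / S\<close>; \<delta> and
    \<open>S\<close> are chosen to make each at most \<open>e / 2\<close>.\<close>
  define \<delta> where "\<delta> = min 1 (e / (4 * (T + 1)))"
  have \<delta>: "0 < \<delta>" "\<delta> \<le> 1" using e T by (auto simp: \<delta>_def)
  have "\<delta> \<le> e / (4 * (T + 1))" by (simp add: \<delta>_def)
  then have "\<delta> * (4 * (T + 1)) \<le> e" using T by (simp add: field_simps)
  then have \<delta>T: "2 * \<delta> * T \<le> e / 2" using \<delta> by (simp add: algebra_simps)
  obtain S0 where S0: "0 < S0"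
    "\<And>S L g t. S0 \<le> S \<Longrightarrow> S \<le> L \<Longrightarrow> geodesic_on L g \<Longrightarrow> dist (g 0) (c 0) = d \<Longrightarrow>
       \<delta> * S + d \<le> dist (g S) (ray_proj c (g S)) \<Longrightarrow> 0 \<le> t \<Longrightarrow>
       \<delta> / 4 * L - 2 * (S + d) \<le> dist (g L) (c t) - t"
    using escape_estimate[OF \<kappa> con \<delta> d] by blast
  define S where "S = max S0 (max T (2 * T * (3 * d + D0) / e))"
  have S: "S0 \<le> S" "T \<le> S" "0 < S" using S0(1) by (auto simp: S_def)
  have "2 * T * (3 * d + D0) / e \<le> S" by (simp add: S_def)
  then have ST: "T * (3 * d + D0) \<le> e / 2 * S" using e by (simp add: field_simps)
  \<comment> \<open>From \<open>R\<close> on, the escape bound at the endpoint is at least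
    \<open>M + 1\<close>.\<close>
  define R where "R = max S ((M + 1 + 2 * (S + d)) * 4 / \<delta>)"
  have "dist (g u) (b u) \<le> e"
    if R: "R \<le> dist (b 0) x" and g: "geodesic_path g (b 0) x" and M: "busemann c x \<le> M"
      and u: "u \<in> {0..T}" for x g u
  proof -
    define L where "L = dist (b 0) x"
    have L: "S \<le> L" "(M + 1 + 2 * (S + d)) * 4 / \<delta> \<le> L" using R by (auto simp: R_def L_def)
    then have LM: "M + 1 \<le> \<delta> / 4 * L - 2 * (S + d)" using \<delta> by (simp add: field_simps)
    have g': "g 0 = b 0" "g L = x" "geodesic_on L g"
      using g unfolding geodesic_path_iff L_def by auto
    define D where "D = dist (g S) (ray_proj c (g S))"
    have D: "D < \<delta> * S + d"
    proof (rule ccontr)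
      assume "\<not> ?thesis"
      then have "\<delta> / 4 * L - 2 * (S + d) \<le> dist x (c t) - t" if "0 \<le> t" for t
        using S0(2)[OF S(1) L(1) g'(3) _ _ that] g' by (simp add: D_def d_def)
      then have "\<delta> / 4 * L - 2 * (S + d) \<le> busemann c x"
        by (rule busemann_geI[OF c])
      then show False using LM M by linarith
    qed
    define q where "q = proj_param c (g S)"
    have q: "0 \<le> q" "D = dist (g S) (c q)"
      by (simp_all add: q_def D_def ray_proj_eq[OF c, symmetric])
    have gS: "dist (b 0) (g S) = S"
      using geodesic_onD[OF g'(3), of 0 S] S L g'(1) by simp
    have cq: "dist (c 0) (c q) = q" "dist (c q) (c S) = \<bar>q - S\<bar>"
      using geodesic_rayD[OF c] q S by simp_all
    \<comment> \<open>Two triangle inequalities show that \<open>q\<close> differs from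
      \<open>S\<close> by at most \<open>d + D\<close>.\<close>
    have "q \<le> d + S + D"
      using dist_triangle[of "c 0" "c q" "b 0"] dist_triangle[of "b 0" "c q" "g S"] cq gS q
      by (simp add: d_def dist_commute)
    moreover have "S \<le> d + q + D"
      using dist_triangle[of "b 0" "g S" "c 0"] dist_triangle[of "c 0" "g S" "c q"] cq gS q
      by (simp add: d_def dist_commute)
    ultimately have "dist (g S) (c S) \<le> 2 * D + d"
      using dist_triangle[of "g S" "c S" "c q"] cq q by linarith
    moreover have "dist (c S) (b S) \<le> D0" using D0 S by (simp add: dist_commute)
    ultimately have *: "dist (g S) (b S) \<le> 2 * \<delta> * S + (3 * d + D0)"
      using D dist_triangle[of "g S" "b S" "c S"] by linarith
    have us: "0 \<le> u / S" "u / S \<le> 1" "u / S * S = u" "u / S \<le> T / S"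
      using u S by (auto simp: divide_right_mono)
    have "dist (g u) (b u) \<le> u / S * dist (g S) (b S)"
      using dist_fan_le[OF geodesic_on_mono[OF g'(3) L(1)] geodesic_ray_on[OF b, of S] g'(1) _ _ us(1,2)]
        S us(3) by simp
    also have "\<dots> \<le> T / S * (2 * \<delta> * S + (3 * d + D0))"
      using us * T S by (intro mult_mono) auto
    also have "\<dots> = 2 * \<delta> * T + T * (3 * d + D0) / S"
      using S by (simp add: field_simps)
    also have "\<dots> \<le> e / 2 + e / 2"
      using \<delta>T ST S by (intro add_mono) (auto simp: field_simps)
    finally show ?thesis by simp
  qed
  then show ?thesis using that by blast
qed

section \<open>An obtuse comparison angle between the two rays\<close>

lemma obtuse_comparison_angle:
  fixes c c' :: "real \<Rightarrow> 'a::cat0_space"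
  assumes \<kappa>: "sublinear \<kappa>" and con: "contracting_ray \<kappa> c" and c': "geodesic_ray c'"
    and 0: "c 0 = c' 0" and ne: "\<exists>t\<ge>0. c t \<noteq> c' t"
  obtains \<epsilon> R where "0 < \<epsilon>" "0 < R"
    "\<And>s t. R \<le> s \<Longrightarrow> R \<le> t \<Longrightarrow> s + \<epsilon> * t \<le> dist (c t) (c' s)"
    "\<And>s t. R \<le> s \<Longrightarrow> R \<le> t \<Longrightarrow> t + \<epsilon> * s \<le> dist (c t) (c' s)"
proof -
  have c: "geodesic_ray c" using con by (simp add: contracting_ray_def)
  define D where "D s = dist (c' s) (ray_proj c (c' s))" for s
  obtain s1 where s1: "0 \<le> s1" "c s1 \<noteq> c' s1" using ne by blast
  \<comment> \<open>A point of \<open>c'\<close> lying on \<open>c\<close> has the same parameter on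
    both rays, as they share their origin.\<close>
  have "D s1 \<noteq> 0"
  proof
    assume "D s1 = 0"
    then have eq: "c' s1 = c (proj_param c (c' s1))" by (simp add: D_def ray_proj_eq[OF c, symmetric])
    have "proj_param c (c' s1) = dist (c' 0) (c' s1)"
      using geodesic_rayD[OF c, of 0 "proj_param c (c' s1)"] eq 0 by simp
    also have "\<dots> = s1" using geodesic_rayD[OF c', of 0 s1] s1 by simp
    finally show False using eq s1 by simp
  qed
  then have D1: "0 < D s1" by (simp add: D_def)
  have s1pos: "0 < s1" using s1 0 by (cases "s1 = 0") auto
  \<comment> \<open>\<delta> is at most the rate at which \<open>c'\<close> has left
    \<open>c\<close> by \<open>s1\<close>; convexity preserves this rate at every later parameter,
    in particular at \<open>S\<close>.\<close>
  define \<delta> where "\<delta> = min 1 (D s1 / s1)"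
  have \<delta>: "0 < \<delta>" "\<delta> \<le> 1" "\<delta> \<le> D s1 / s1" using D1 s1pos by (auto simp: \<delta>_def)
  obtain S0 where S0: "0 < S0"
    "\<And>S L g t. S0 \<le> S \<Longrightarrow> S \<le> L \<Longrightarrow> geodesic_on L g \<Longrightarrow> dist (g 0) (c 0) = 0 \<Longrightarrow>
       \<delta> * S + 0 \<le> dist (g S) (ray_proj c (g S)) \<Longrightarrow> 0 \<le> t \<Longrightarrow>
       \<delta> / 4 * L - 2 * (S + 0) \<le> dist (g L) (c t) - t"
    using escape_estimate[OF \<kappa> con \<delta>(1,2) order_refl] by blast
  define S where "S = max S0 s1"
  have S: "S0 \<le> S" "s1 \<le> S" "0 < S" using s1pos by (auto simp: S_def)
  have "D s1 \<le> s1 / S * D S"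
    using dist_ray_proj_scale[OF c geodesic_ray_on[OF c', of S], of s1] S s1 0
    by (simp add: D_def)
  then have "D s1 / s1 \<le> D S / S" using S s1pos by (simp add: field_simps)
  then have "\<delta> \<le> D S / S" using \<delta>(3) by linarith
  then have far: "\<delta> * S + 0 \<le> D S" using S by (simp add: field_simps)
  \<comment> \<open>Chosen so that the escape bound along \<open>c'\<close> is at least 1, uniformly
    in \<open>t\<close>.\<close>
  define s0 where "s0 = max S ((2 * S + 1) * 4 / \<delta>)"
  have s0: "S \<le> s0" "(2 * S + 1) * 4 / \<delta> \<le> s0" "0 < s0" using S by (auto simp: s0_def)
  then have "2 * S + 1 \<le> \<delta> / 4 * s0" using \<delta> by (simp add: field_simps)
  then have gap: "t + 1 \<le> dist (c' s0) (c t)" if "0 \<le> t" for t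
    using S0(2)[OF S(1) s0(1) geodesic_ray_on[OF c'] _ _ that] far 0 by (simp add: D_def)
  \<comment> \<open>With this choice \<open>(t0 + 1)\<^sup>2\<close> exceeds
    \<open>s0\<^sup>2 + t0\<^sup>2\<close> by more than 1, so the comparison angle at the origin is
    obtuse; its cosine is at most \<open>- \<epsilon>\<close>.\<close>
  define t0 where "t0 = s0\<^sup>2"
  have t0: "0 < t0" using s0 by (simp add: t0_def)
  define \<epsilon> where "\<epsilon> = min 1 (1 / (2 * s0 * t0))"
  have \<epsilon>: "0 < \<epsilon>" "\<epsilon> \<le> 1" using s0 t0 by (auto simp: \<epsilon>_def)
  have "\<epsilon> \<le> 1 / (2 * s0 * t0)" by (simp add: \<epsilon>_def)
  then have "2 * \<epsilon> * (s0 * t0) \<le> 1" using s0 t0 by (simp add: field_simps)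
  moreover have "(t0 + 1)\<^sup>2 \<le> (dist (c' s0) (c t0))\<^sup>2"
    using gap[of t0] t0 by (intro power_mono) auto
  ultimately have obt: "s0\<^sup>2 + t0\<^sup>2 + 2 * \<epsilon> * (s0 * t0) \<le> (dist (c' s0) (c t0))\<^sup>2"
    using t0 by (simp add: t0_def power2_eq_square algebra_simps)
  \<comment> \<open>Monotonicity of comparison angles carries the bound on the cosine to all larger
    parameters.\<close>
  have sq: "s\<^sup>2 + t\<^sup>2 + 2 * \<epsilon> * (s * t) \<le> (dist (c t) (c' s))\<^sup>2" if s: "s0 \<le> s" and t: "t0 \<le> t" for s t
  proof -
    have p: "0 < s" "0 < t" using s t s0 t0 by linarith+
    have "(dist (c' s0) (c t0))\<^sup>2
        \<le> s0\<^sup>2 + t0\<^sup>2 - s0 * t0 / (s * t) * (s\<^sup>2 + t\<^sup>2 - (dist (c' s) (c t))\<^sup>2)"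
      using cat0_cosine[OF geodesic_ray_on[OF c', of s] geodesic_ray_on[OF c, of t] 0[symmetric] p]
        s t s0 t0 by simp
    with obt have "2 * \<epsilon> * (s0 * t0) \<le> - (s0 * t0 / (s * t) * (s\<^sup>2 + t\<^sup>2 - (dist (c' s) (c t))\<^sup>2))"
      by linarith
    then have "s0 * t0 * (2 * \<epsilon> * (s * t)) \<le> s0 * t0 * (- (s\<^sup>2 + t\<^sup>2 - (dist (c' s) (c t))\<^sup>2))"
      using p by (simp add: field_simps)
    then show ?thesis using s0 t0 by (simp add: dist_commute)
  qed
  \<comment> \<open>Since \<open>\<epsilon> \<le> 1\<close>, either square on the left of
    \<open>sq\<close> may be shrunk by \<open>\<epsilon>\<^sup>2\<close>, which completes a square
    in two symmetric ways.\<close>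
  have eps2: "\<epsilon>\<^sup>2 * r\<^sup>2 \<le> r\<^sup>2" for r
    using \<epsilon> by (simp add: mult_left_le_one_le power_le_one)
  define R where "R = max s0 t0"
  have "s + \<epsilon> * t \<le> dist (c t) (c' s)" "t + \<epsilon> * s \<le> dist (c t) (c' s)" if "R \<le> s" "R \<le> t" for s t
  proof -
    have *: "s\<^sup>2 + t\<^sup>2 + 2 * \<epsilon> * (s * t) \<le> (dist (c t) (c' s))\<^sup>2"
      using sq that by (simp add: R_def)
    have "(s + \<epsilon> * t)\<^sup>2 \<le> (dist (c t) (c' s))\<^sup>2"
      using * eps2[of t] by (simp add: power2_eq_square algebra_simps)
    then show "s + \<epsilon> * t \<le> dist (c t) (c' s)" by (rule power2_le_imp_le) simp
    have "(t + \<epsilon> * s)\<^sup>2 \<le> (dist (c t) (c' s))\<^sup>2"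
      using * eps2[of s] by (simp add: power2_eq_square algebra_simps)
    then show "t + \<epsilon> * s \<le> dist (c t) (c' s)" by (rule power2_le_imp_le) simp
  qed
  then show ?thesis using that[of \<epsilon> R] \<epsilon> s0 by (simp add: R_def less_max_iff_disj)
qed

section \<open>Convergence to the endpoint, intersections of horoballs, and growth along the other
  ray\<close>

lemma tends_to_endpoint:
  fixes c :: "real \<Rightarrow> 'a::{cat0_space, complete_space}"
  assumes \<kappa>: "sublinear \<kappa>" and con: "contracting_ray \<kappa> c"
    and x: "filterlim (\<lambda>k. busemann c (x k)) at_bot sequentially"
  shows "tends_to_boundary p x (endpoint c)"
proof -
  have c: "geodesic_ray c" using con by (simp add: contracting_ray_def)
  \<comment> \<open>The Busemann function is at least minus the distance to \<open>c 0\<close>, so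
    values tending to minus infinity force the points to leave every ball.\<close>
  have "filterlim (\<lambda>k. - busemann c (x k) - dist p (c 0)) at_top sequentially"
    unfolding filterlim_at_top
  proof
    fix Z
    have "\<forall>\<^sub>F k in sequentially. busemann c (x k) \<le> - Z - dist p (c 0)"
      using x unfolding filterlim_at_bot by blast
    then show "\<forall>\<^sub>F k in sequentially. Z \<le> - busemann c (x k) - dist p (c 0)"
      by eventually_elim simp
  qed
  then have far: "filterlim (\<lambda>k. dist p (x k)) at_top sequentially"
  proof (rule filterlim_at_top_mono, intro always_eventually allI)
    fix k
    show "- busemann c (x k) - dist p (c 0) \<le> dist p (x k)"
      using busemann_ge_neg_dist[OF c, of "x k"] dist_triangle[of "x k" "c 0" p]
      by (simp add: dist_commute)
  qed
  obtain b where b: "geodesic_ray b" "b 0 = p" "endpoint b = endpoint c"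
    using asymptotic_ray_exists[OF c] by blast
  obtain \<sigma> where \<sigma>: "\<And>k. geodesic_path (\<sigma> k) p (x k)"
    using geodesic_path_exists[of p "x _"] by metis
  have "uniform_limit {0..T} \<sigma> b sequentially" if T: "0 \<le> T" for T
    unfolding uniform_limit_iff
  proof (intro allI impI)
    fix e :: real assume e: "0 < e"
    \<comment> \<open>The level 0 is an arbitrary bound that holds for all late \<open>k\<close>;
      \<open>e / 2\<close> makes the final inequality strict.\<close>
    then obtain R where R: "\<And>x g u. R \<le> dist (b 0) x \<Longrightarrow> geodesic_path g (b 0) x \<Longrightarrow>
       busemann c x \<le> 0 \<Longrightarrow> u \<in> {0..T} \<Longrightarrow> dist (g u) (b u) \<le> e / 2"
      using visibility_estimate[OF \<kappa> con b(1,3) _ T, of "e / 2" 0] by auto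
    have "\<forall>\<^sub>F k in sequentially. R \<le> dist p (x k)" "\<forall>\<^sub>F k in sequentially. busemann c (x k) \<le> 0"
      using far x unfolding filterlim_at_top filterlim_at_bot by blast+
    then show "\<forall>\<^sub>F k in sequentially. \<forall>u\<in>{0..T}. dist (\<sigma> k u) (b u) < e"
    proof eventually_elim
      case (elim k)
      then have "dist (\<sigma> k u) (b u) \<le> e / 2" if "u \<in> {0..T}" for u
        using R[of "x k" "\<sigma> k" u] \<sigma> b(2) that by blast
      then show ?case using e by force
    qed
  qed
  then show ?thesis
    unfolding tends_to_boundary_def using far b \<sigma> by blast
qed

lemma bounded_horoball_inter:
  fixes c c' :: "real \<Rightarrow> 'a::cat0_space"
  assumes \<kappa>: "sublinear \<kappa>" and con: "contracting_ray \<kappa> c" and c': "geodesic_ray c'"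
    and 0: "c 0 = c' 0" and ne: "\<exists>t\<ge>0. c t \<noteq> c' t"
  shows "bounded {x. busemann c x \<le> M \<and> busemann c' x \<le> M'}"
proof -
  have c: "geodesic_ray c" using con by (simp add: contracting_ray_def)
  define N where "N = max 0 M'"
  obtain \<epsilon> R where \<epsilon>: "0 < \<epsilon>" "0 < R"
    "\<And>s t. R \<le> s \<Longrightarrow> R \<le> t \<Longrightarrow> s + \<epsilon> * t \<le> dist (c t) (c' s)"
    using obtuse_comparison_angle[OF assms] by metis
  \<comment> \<open>The 3 covers the slack in the Busemann limit, the distance from
    \<open>g T\<close> to \<open>c T\<close>, and a final strict inequality.\<close>
  define T where "T = max R ((N + 3) / \<epsilon>)"
  have T: "R \<le> T" "(N + 3) / \<epsilon> \<le> T" "0 \<le> T" using \<epsilon> by (auto simp: T_def)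
  then have \<epsilon>T: "N + 3 \<le> \<epsilon> * T" using \<epsilon> by (simp add: field_simps)
  obtain R' where R': "\<And>x g u. R' \<le> dist (c 0) x \<Longrightarrow> geodesic_path g (c 0) x \<Longrightarrow>
     busemann c x \<le> M \<Longrightarrow> u \<in> {0..T} \<Longrightarrow> dist (g u) (c u) \<le> 1"
    using visibility_estimate[OF \<kappa> con c refl zero_less_one T(3), of M] by blast
  have "dist (c 0) x \<le> max R' T" if x: "busemann c x \<le> M" "busemann c' x \<le> M'" for x
  proof (rule ccontr)
    assume "\<not> ?thesis"
    then have far: "R' \<le> dist (c 0) x" "T \<le> dist (c 0) x" by auto
    obtain g where g: "geodesic_path g (c 0) x" using geodesic_path_exists by blast
    then have g': "g 0 = c 0" "g (dist (c 0) x) = x" "geodesic_on (dist (c 0) x) g"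
      by (auto simp: geodesic_path_iff)
    have near: "dist (g T) (c T) \<le> 1" using R'[OF far(1) g x(1)] T by simp
    have "busemann c' x < N + 1" using x by (simp add: N_def)
    then have "\<forall>\<^sub>F s in at_top. dist x (c' s) - s < N + 1"
      by (rule order_tendstoD(2)[OF busemann_tendsto[OF c']])
    then obtain s where s: "R \<le> s" "dist x (c' s) - s < N + 1"
      unfolding eventually_at_top_linorder by (metis linorder_le_cases)
    have "dist (c 0) (c' s) = s" using geodesic_rayD[OF c', of 0 s] s \<epsilon> 0 by simp
    \<comment> \<open>Both ends of \<open>g\<close> lie within \<open>s + N + 1\<close> of
      \<open>c' s\<close>: the origin because \<open>N \<ge> 0\<close>, and \<open>x\<close> by the
      choice of \<open>s\<close>. Convexity of balls covers \<open>g T\<close>.\<close>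
    then have "dist (g T) (c' s) \<le> s + N + 1"
      using dist_geodesic_le_max[OF g'(3) T(3) far(2), of "c' s"] g' s by (simp add: N_def)
    then have "dist (c T) (c' s) \<le> s + N + 2"
      using near dist_triangle[of "c T" "c' s" "g T"] by (simp add: dist_commute)
    then show False using \<epsilon>(3)[OF s(1) T(1)] \<epsilon>T by linarith
  qed
  then show ?thesis unfolding bounded_def by (intro exI) auto
qed

text \<open>The two bounds of \<open>obtuse_comparison_angle\<close> are exchanged by swapping the
  rays, so this form serves both limits.\<close>

lemma busemann_at_top:
  fixes c c' :: "real \<Rightarrow> 'a::metric_space"
  assumes c: "geodesic_ray c" and \<epsilon>: "0 < \<epsilon>"
    and le: "\<And>s t. R \<le> s \<Longrightarrow> R \<le> t \<Longrightarrow> t + \<epsilon> * s \<le> dist (c' s) (c t)"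
  shows "filterlim (\<lambda>s. busemann c (c' s) + n) at_top at_top"
proof -
  have "filterlim (\<lambda>s. \<epsilon> * s + n) at_top at_top"
    using \<epsilon> by real_asymp
  then show ?thesis
  proof (rule filterlim_at_top_mono)
    show "\<forall>\<^sub>F s in at_top. \<epsilon> * s + n \<le> busemann c (c' s) + n"
      using eventually_ge_at_top[of R]
    proof eventually_elim
      case (elim s)
      have "\<epsilon> * s \<le> busemann c (c' s)"
        using le[OF elim] by (intro busemann_geI[OF c, of R]) (simp add: algebra_simps)
      then show ?case by simp
    qed
  qed
qed

theorem theorem1:
  fixes \<kappa> :: "real \<Rightarrow> real"
    and c c' :: "real \<Rightarrow> 'a::{cat0_space, heine_borel}"
    and \<zeta> \<eta> :: "(real \<Rightarrow> 'a) set"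
    and h :: "'a \<Rightarrow> real"
    and \<oo> :: 'a
  assumes "sublinear \<kappa>"
    and "geodesic_ray c" and "geodesic_ray c'"
    and "c 0 = c' 0" and "\<exists>t\<ge>0. c t \<noteq> c' t"
    and "contracting_ray \<kappa> c"
    and "\<zeta> = endpoint c" and "\<eta> = endpoint c'"
    and "horofunction c h"
  shows
    "((\<forall>x :: nat \<Rightarrow> 'a. filterlim (\<lambda>k. h (x k)) at_bot sequentially \<longrightarrow> tends_to_boundary \<oo> x \<zeta>) \<and>
      convergent_horospheres \<oo> (\<lambda>k. horosphere h (real k)) \<zeta>) \<and>
     (\<forall>B B'. horoball_centered_at \<zeta> B \<and> horoball_centered_at \<eta> B' \<longrightarrow> bounded (B \<inter> B')) \<and>
     (\<forall>h'. horofunction c' h' \<longrightarrow>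
        filterlim (\<lambda>s. h (c' s)) at_top at_top \<and> filterlim (\<lambda>t. h' (c t)) at_top at_top)"
proof -
  obtain n where h: "h = (\<lambda>x. busemann c x + n)" using assms(9) by (auto simp: horofunction_def)
  have lim: "tends_to_boundary \<oo> x \<zeta>" if x: "filterlim (\<lambda>k. h (x k)) at_bot sequentially" for x
    unfolding assms(7)
  proof (rule tends_to_endpoint[OF assms(1,6)])
    show "filterlim (\<lambda>k. busemann c (x k)) at_bot sequentially"
      unfolding filterlim_at_bot
    proof
      fix Z
      have "\<forall>\<^sub>F k in sequentially. h (x k) \<le> Z + n" using x unfolding filterlim_at_bot by blast
      then show "\<forall>\<^sub>F k in sequentially. busemann c (x k) \<le> Z" by (simp add: h)
    qed
  qed
  \<comment> \<open>On the \<open>k\<close>-th horosphere \<open>h\<close> is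
    \<open>- real k\<close>, so convergence of horospheres is a case of \<open>lim\<close>.\<close>
  have "filterlim (\<lambda>k. - real k) at_bot sequentially"
    by real_asymp
  then have conv: "convergent_horospheres \<oo> (\<lambda>k. horosphere h (real k)) \<zeta>"
    unfolding convergent_horospheres_def horosphere_def using lim by simp
  have bdd: "bounded (B \<inter> B')"
    if B: "horoball_centered_at \<zeta> B" and B': "horoball_centered_at \<eta> B'" for B B'
  proof -
    \<comment> \<open>The horoball may be defined by another ray \<open>b\<close> with the same
      endpoint, whose Busemann function differs from that of \<open>c\<close> by a bounded
      amount.\<close>
    have *: "\<exists>M. B \<subseteq> {x. busemann c x \<le> M}"
      if c: "geodesic_ray c" and B: "horoball_centered_at (endpoint c) B" for c and B :: "'a set"
    proof -
      obtain b m k where b: "geodesic_ray b" "endpoint b = endpoint c"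
        and B: "B = horoball (\<lambda>x. busemann b x + m) k"
        using B unfolding horoball_centered_at_def horofunction_def by blast
      obtain D where "\<And>x. busemann c x \<le> busemann b x + D"
        using busemann_asymptotic_le[OF c b(1) b(2)[symmetric]] by blast
      then have "busemann c x \<le> - k - m + D" if "x \<in> B" for x
        using that unfolding B horoball_def by (smt (verit) atMost_iff vimageD)
      then show ?thesis by blast
    qed
    obtain M where "B \<subseteq> {x. busemann c x \<le> M}"
      using *[OF assms(2)] B unfolding assms(7) by blast
    moreover obtain M' where "B' \<subseteq> {x. busemann c' x \<le> M'}"
      using *[OF assms(3)] B' unfolding assms(8) by blast
    ultimately have "B \<inter> B' \<subseteq> {x. busemann c x \<le> M \<and> busemann c' x \<le> M'}" by blast
    then show ?thesis
      by (rule bounded_subset[OF bounded_horoball_inter[OF assms(1,6,3,4,5)]])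
  qed
  obtain \<epsilon> R where \<epsilon>: "0 < \<epsilon>"
    "\<And>s t. R \<le> s \<Longrightarrow> R \<le> t \<Longrightarrow> s + \<epsilon> * t \<le> dist (c t) (c' s)"
    "\<And>s t. R \<le> s \<Longrightarrow> R \<le> t \<Longrightarrow> t + \<epsilon> * s \<le> dist (c' s) (c t)"
    using obtuse_comparison_angle[OF assms(1,6,3,4,5)] by (metis dist_commute)
  have "filterlim (\<lambda>s. h (c' s)) at_top at_top"
    unfolding h by (rule busemann_at_top[OF assms(2) \<epsilon>(1,3)])
  moreover have "filterlim (\<lambda>t. h' (c t)) at_top at_top" if "horofunction c' h'" for h'
    using that busemann_at_top[OF assms(3) \<epsilon>(1,2)] by (auto simp: horofunction_def)
  ultimately show ?thesis using lim conv bdd by blast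
qed

end
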